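(* Consider the convex problem (P), its dual (D), and the accelerated augmented Lagrangian method (AALM) described in the context. Suppose the solution set of (D) is nonempty, let $\delta>0$, and let the AALM be executed under criterion (C) with $\varepsilon_k=\frac{1}{(k+2)^{1+\delta}}$, $k=0,1,\ldots$, generating $\{x^k\}\subseteq C$ and $\{y^k\}\subset\mathbb{R}^m_+$. Let $\Delta_0$ be a constant satisfying $\|y^k\|\le\Delta_0$ for $k=0,1,2,\ldots$, and for $k\ge1$ let $$\tilde x^k=\Big(\sum_{l=1}^k c_{l-1}\Big)^{-1}\sum_{j=1}^k c_{j-1}x^j .$$ (1) If $\{c_k\}$ is a sequence of increasing positive parameters with $c_0>0$, then for all $k\ge 1$ $$f_i(\tilde x^k)\le\frac{1}{c_0k}\big[3\Delta_0+2\Delta_0\ln k\big],\quad i=1,\ldots,m,$$ $$f_0(\tilde x^k)-\operatorname{asym}\inf(P)\le\frac{1}{2c_0k}\left[\frac{2(1+\delta)}{1+2\delta}+13\Delta_0^2+12\Delta_0^2\ln k\right].$$ (2) If $c_k=c_0(k+1)$ with $c_0>0$, then for all $k\ge1$ $$f_i(\tilde x^k)\le\frac{2}{c_0k(k+1)}\big[3\Delta_0+2\Delta_0\ln k\big],\quad i=1,\ldots,m,$$ $$f_0(\tilde x^k)-\operatorname{asym}\inf(P)\le\frac{1}{c_0k(k+1)}\left[\frac{2(1+\delta)}{1+2\delta}+13\Delta_0^2+12\Delta_0^2\ln k\right].$$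
   Context: Problem (P): minimize $f_0(x)$ over $x\in C$ subject to $f_j(x)\le 0$, $j=1,\ldots,m$, where $C\subseteq\mathbb{R}^n$ is a nonempty closed convex set and $f_i:\mathbb{R}^n\to\mathbb{R}$ is a lower semicontinuous convex function, $i=0,1,\ldots,m$. Write $F(x)=(f_1(x),\ldots,f_m(x))$. Problem (D): maximize $g_0(y)=\inf_{x\in C}\{f_0(x)+\sum_{j=1}^m y_jf_j(x)\}$ subject to $y\ge 0$, $y\in\mathbb{R}^m$; it is understood that $\sup(D)>-\infty$. For $c>0$, $y\in\mathbb{R}^m$, let $Y(x,y,c)=\Pi_{\mathbb{R}^m_+}[y+cF(x)]$ ($\Pi_{\mathbb{R}^m_+}$ the Euclidean projection onto the nonnegative orthant), and define the augmented Lagrangian $L(x,y,c)=f_0(x)+\frac{1}{2c}\big[\|\Pi_{\mathbb{R}^m_+}[y+cF(x)]\|^2-\|y\|^2\big]$ for $x\in C$ and $L(x,y,c)=+\infty$ for $x\notin C$. AALM: choose $y^0\in\mathbb{R}^m_+$ and parameters $c_k>0$. For $k=0,1,2,\ldots$, with $\phi_k(x)=L(x,y^k,c_k)$: compute $x^{k+1}\approx\arg\min\phi_k$ according to criterion (C); set $\bar y^k=Y(x^{k+1},y^k,c_k)$ and $y^{k+1}=\frac{1}{k+2}y^0+\frac{k+1}{k+2}\bar y^k$. Criterion (C): $\phi_k(x^{k+1})-\inf\phi_k\le\varepsilon_k^2/(2c_k)$ for all $k$, where $\varepsilon_k\ge0$ and $\sum_{k=0}^\infty\varepsilon_k<+\infty$.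 $\operatorname{asym}\inf(P)$ (the asymptotic infimum) is the smallest possible value of $\limsup_k f_0(u^k)$ among all sequences $\{u^k\}\subseteq C$ with $\limsup_k f_i(u^k)\le0$ for $i=1,\ldots,m$. *)

theory Defs
  imports "HOL-Analysis.Analysis"
begin

definition lsc :: "('a::topological_space \<Rightarrow> real) \<Rightarrow> bool" where
  "lsc f \<longleftrightarrow> (\<forall>x. \<forall>r < f x. eventually (\<lambda>z. r < f z) (nhds x))"

definition nonneg_orthant :: "(real ^ 'm) set" where
  "nonneg_orthant = {y. \<forall>j. 0 \<le> y $ j}"

definition constr_map :: "('m \<Rightarrow> 'a \<Rightarrow> real) \<Rightarrow> 'a \<Rightarrow> real ^ 'm" where
  "constr_map f x = (\<chi> j. f j x)"

definition dual_obj ::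
  "'a set \<Rightarrow> ('a \<Rightarrow> real) \<Rightarrow> ('m::finite \<Rightarrow> 'a \<Rightarrow> real) \<Rightarrow> real ^ 'm \<Rightarrow> ereal" where
  "dual_obj C f0 f y = (INF x\<in>C. ereal (f0 x + (\<Sum>j\<in>UNIV. y $ j * f j x)))"

definition dual_sup ::
  "'a set \<Rightarrow> ('a \<Rightarrow> real) \<Rightarrow> ('m::finite \<Rightarrow> 'a \<Rightarrow> real) \<Rightarrow> ereal" where
  "dual_sup C f0 f = (SUP y\<in>nonneg_orthant. dual_obj C f0 f y)"

definition dual_solutions ::
  "'a set \<Rightarrow> ('a \<Rightarrow> real) \<Rightarrow> ('m::finite \<Rightarrow> 'a \<Rightarrow> real) \<Rightarrow> (real ^ 'm) set" where
  "dual_solutions C f0 f = {y \<in> nonneg_orthant. dual_obj C f0 f y = dual_sup C f0 f}"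

definition multiplier_update ::
  "('m::finite \<Rightarrow> 'a \<Rightarrow> real) \<Rightarrow> 'a \<Rightarrow> real ^ 'm \<Rightarrow> real \<Rightarrow> real ^ 'm" where
  "multiplier_update f x y c = closest_point nonneg_orthant (y + c *\<^sub>R constr_map f x)"

definition aug_lagrangian ::
  "'a set \<Rightarrow> ('a \<Rightarrow> real) \<Rightarrow> ('m::finite \<Rightarrow> 'a \<Rightarrow> real) \<Rightarrow> 'a \<Rightarrow> real ^ 'm \<Rightarrow> real \<Rightarrow> ereal" where
  "aug_lagrangian C f0 f x y c =
     (if x \<in> C
      then ereal (f0 x + 1 / (2 * c) *
             ((norm (closest_point nonneg_orthant (y + c *\<^sub>R constr_map f x)))\<^sup>2 - (norm y)\<^sup>2))
      else \<infinity>)"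

(* The infimum is over the whole space. If it is -\<infinity>, or if x (Suc k) is not in C, the
   left-hand side of the last inequality is \<infinity>, so the criterion fails. *)
definition criterion_C ::
  "'a set \<Rightarrow> ('a \<Rightarrow> real) \<Rightarrow> ('m::finite \<Rightarrow> 'a \<Rightarrow> real) \<Rightarrow> (nat \<Rightarrow> real) \<Rightarrow> (nat \<Rightarrow> real) \<Rightarrow>
   (nat \<Rightarrow> 'a) \<Rightarrow> (nat \<Rightarrow> real ^ 'm) \<Rightarrow> bool" where
  "criterion_C C f0 f c \<epsilon> x y \<longleftrightarrow>
     (\<forall>k. 0 \<le> \<epsilon> k) \<and> summable \<epsilon> \<and>
     (\<forall>k. aug_lagrangian C f0 f (x (Suc k)) (y k) (c k)
            - (INF z. aug_lagrangian C f0 f z (y k) (c k))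
          \<le> ereal ((\<epsilon> k)\<^sup>2 / (2 * c k)))"

(* A run of the accelerated method: x (Suc k) is chosen by criterion (C), so x 0 plays no role. *)
definition aalm ::
  "'a set \<Rightarrow> ('a \<Rightarrow> real) \<Rightarrow> ('m::finite \<Rightarrow> 'a \<Rightarrow> real) \<Rightarrow> (nat \<Rightarrow> real) \<Rightarrow> (nat \<Rightarrow> real) \<Rightarrow>
   (nat \<Rightarrow> 'a) \<Rightarrow> (nat \<Rightarrow> real ^ 'm) \<Rightarrow> bool" where
  "aalm C f0 f c \<epsilon> x y \<longleftrightarrow>
     y 0 \<in> nonneg_orthant \<and> (\<forall>k. 0 < c k) \<and> criterion_C C f0 f c \<epsilon> x y \<and>
     (\<forall>k. y (Suc k) = (1 / (real k + 2)) *\<^sub>R y 0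
            + ((real k + 1) / (real k + 2)) *\<^sub>R multiplier_update f (x (Suc k)) (y k) (c k))"

lemma aalm_iterates_mem:
  assumes "aalm C f0 f c \<epsilon> x y"
  shows "x (Suc k) \<in> C"
proof (rule ccontr)
  assume "x (Suc k) \<notin> C"
  moreover have "aug_lagrangian C f0 f (x (Suc k)) (y k) (c k)
      - (INF z. aug_lagrangian C f0 f z (y k) (c k)) \<le> ereal ((\<epsilon> k)\<^sup>2 / (2 * c k))"
    using assms by (simp add: aalm_def criterion_C_def)
  ultimately show False by (simp add: aug_lagrangian_def)
qed

(* The infimum of the possible values of limsup f0(u k); by a diagonal argument it is attained
   whenever an asymptotically feasible sequence exists, and it is \<infinity> otherwise. *)
definition asym_inf ::
  "'a set \<Rightarrow> ('a \<Rightarrow> real) \<Rightarrow> ('m::finite \<Rightarrow> 'a \<Rightarrow> real) \<Rightarrow> ereal" where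
  "asym_inf C f0 f =
     Inf {limsup (\<lambda>k. ereal (f0 (u k))) | u :: nat \<Rightarrow> 'a.
            (\<forall>k. u k \<in> C) \<and> (\<forall>i. limsup (\<lambda>k. ereal (f i (u k))) \<le> 0)}"

definition weighted_avg :: "(nat \<Rightarrow> real) \<Rightarrow> (nat \<Rightarrow> 'a::real_vector) \<Rightarrow> nat \<Rightarrow> 'a" where
  "weighted_avg c x k = inverse (\<Sum>l=1..k. c (l - 1)) *\<^sub>R (\<Sum>j=1..k. c (j - 1) *\<^sub>R x j)"

end

theory Submission
  imports Defs
begin

text \<open>
  With \<open>z\<^sub>k\<close> the projected multiplier, \<open>c\<^sub>k f\<^sub>i(x\<^sub>k\<^sub>+\<^sub>1)\<close> is at most the \<open>i\<close>-th entry
  of \<open>z\<^sub>k - y\<^sub>k\<close>, and approximate minimality bounds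
  \<open>2 c\<^sub>k (f\<^sub>0(x\<^sub>k\<^sub>+\<^sub>1) - asym inf)\<close> by \<open>\<epsilon>\<^sub>k\<^sup>2 + \<parallel>y\<^sub>k\<parallel>\<^sup>2 - \<parallel>z\<^sub>k\<parallel>\<^sup>2\<close>.  The averaging
  step gives \<open>z\<^sub>k = y\<^sub>k\<^sub>+\<^sub>1 + (y\<^sub>k\<^sub>+\<^sub>1 - y\<^sub>0) / (k + 1)\<close>, so both bounds telescope up to a harmonic
  sum, and convexity transfers the summed inequalities to the weighted average.
\<close>

section \<open>Projection onto the nonnegative orthant\<close>

lemma closest_point_nonneg_orthant:
  fixes z :: "real ^ 'm::finite"
  shows "closest_point nonneg_orthant z = (\<chi> j. max 0 (z $ j))"
proof -
  have conv: "convex (nonneg_orthant :: (real ^ 'm) set)"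
    by (auto simp: convex_def nonneg_orthant_def)
  have clos: "closed (nonneg_orthant :: (real ^ 'm) set)"
    unfolding nonneg_orthant_def
    by (intro closed_Collect_all closed_Collect_le continuous_intros)
  \<comment> \<open>The positive part is nearest in every coordinate separately, so a componentwise
    comparison suffices.\<close>
  have "dist z (\<chi> j. max 0 (z $ j)) \<le> dist z w" if "w \<in> nonneg_orthant" for w
    unfolding dist_norm
  proof (rule norm_le_componentwise_cart)
    fix i
    have "0 \<le> w $ i" using that by (simp add: nonneg_orthant_def)
    then show "norm ((z - (\<chi> j. max 0 (z $ j))) $ i) \<le> norm ((z - w) $ i)"
      by (auto simp: max_def)
  qed
  then have "(\<chi> j. max 0 (z $ j)) = closest_point nonneg_orthant z"
    by (intro closest_point_unique conv clos) (auto simp: nonneg_orthant_def)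
  then show ?thesis by simp
qed

text \<open>Entrywise, \<open>max 0 (y $ i + c * f i u)\<close> is at most
  \<open>y $ i + c * \<eta>\<close>, because the latter is nonnegative. The bound tends to
  \<open>norm y\<close> as \<eta> tends to 0, so nearly feasible points can serve as comparison
  points.\<close>

lemma norm_closest_point_nonneg_orthant_le:
  assumes "y \<in> nonneg_orthant" and "0 < c" and "0 < \<eta>" and "\<And>i. f i u \<le> \<eta>"
  shows "norm (closest_point nonneg_orthant (y + c *\<^sub>R constr_map f u)) \<le> norm (y + (c * \<eta>) *\<^sub>R 1)"
  unfolding closest_point_nonneg_orthant
proof (rule norm_le_componentwise_cart)
  fix i
  have "0 \<le> y $ i" "c * f i u \<le> c * \<eta>" "0 \<le> c * \<eta>"
    using assms by (auto simp: nonneg_orthant_def)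
  then show "norm ((\<chi> j. max 0 ((y + c *\<^sub>R constr_map f u) $ j)) $ i) \<le> norm ((y + (c * \<eta>) *\<^sub>R 1) $ i)"
    by (auto simp: constr_map_def)
qed

lemma multiplier_update_nonneg: "multiplier_update f u y c \<in> nonneg_orthant"
  unfolding multiplier_update_def closest_point_nonneg_orthant
  by (simp add: nonneg_orthant_def)

text \<open>A positive part dominates its argument. This turns multiplier increments into bounds on
  constraint values.\<close>

lemma multiplier_update_ge: "c * f i u \<le> (multiplier_update f u y c - y) $ i"
  by (simp add: multiplier_update_def closest_point_nonneg_orthant constr_map_def)

section \<open>One step of the method\<close>

lemma aalm_multiplier_nonneg:
  assumes "aalm C f0 f c \<epsilon> x y"
  shows "y k \<in> nonneg_orthant"
proof (cases k)
  case 0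
  then show ?thesis using assms by (simp add: aalm_def)
next
  case (Suc n)
  have "0 \<le> y 0 $ i" "0 \<le> multiplier_update f (x (Suc n)) (y n) (c n) $ i" for i
    using assms multiplier_update_nonneg[of f "x (Suc n)" "y n" "c n"]
    by (auto simp: aalm_def nonneg_orthant_def)
  moreover have "y (Suc n) = (1 / (real n + 2)) *\<^sub>R y 0
      + ((real n + 1) / (real n + 2)) *\<^sub>R multiplier_update f (x (Suc n)) (y n) (c n)"
    using assms by (simp add: aalm_def)
  ultimately show ?thesis by (simp add: Suc nonneg_orthant_def)
qed

text \<open>The averaging step solved for the projected multiplier. The deviation from
  \<open>y (Suc k)\<close> carries the factor 1/(k+1), the source of the harmonic sums.\<close>

lemma aalm_multiplier_update_eq:
  assumes "aalm C f0 f c \<epsilon> x y"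
  shows "multiplier_update f (x (Suc k)) (y k) (c k)
    = y (Suc k) + (1 / (real k + 1)) *\<^sub>R (y (Suc k) - y 0)"
proof -
  let ?z = "multiplier_update f (x (Suc k)) (y k) (c k)"
  have "y (Suc k) = (1 / (real k + 2)) *\<^sub>R y 0 + ((real k + 1) / (real k + 2)) *\<^sub>R ?z"
    using assms by (simp add: aalm_def)
  then have "(real k + 2) * y (Suc k) $ i = y 0 $ i + (real k + 1) * ?z $ i" for i
    by (simp add: distrib_left)
  then have "(?z $ i - y (Suc k) $ i) * (real k + 1) = y (Suc k) $ i - y 0 $ i" for i
    by (simp add: algebra_simps)
  then have "?z $ i - y (Suc k) $ i = (y (Suc k) $ i - y 0 $ i) / (real k + 1)" for i
    by (intro eq_divide_imp) auto
  then have "?z $ i = (y (Suc k) + (1 / (real k + 1)) *\<^sub>R (y (Suc k) - y 0)) $ i" for i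
    by (simp add: diff_eq_eq add.commute)
  then show ?thesis by (simp add: vec_eq_iff)
qed

text \<open>Criterion (C) compares with the infimum, hence with every \<open>u\<close> in
  \<open>C\<close>; after multiplication by \<open>2 * c k\<close> the common term in
  \<open>norm (y k)\<close> cancels.\<close>

lemma aalm_approx_min:
  assumes "aalm C f0 f c \<epsilon> x y" and "u \<in> C"
  shows "2 * c k * f0 (x (Suc k)) + (norm (multiplier_update f (x (Suc k)) (y k) (c k)))\<^sup>2
    \<le> 2 * c k * f0 u + (norm (multiplier_update f u (y k) (c k)))\<^sup>2 + (\<epsilon> k)\<^sup>2"
proof -
  let ?L = "\<lambda>z. aug_lagrangian C f0 f z (y k) (c k)"
  have c: "0 < c k" using assms by (simp add: aalm_def)
  have "x (Suc k) \<in> C" using assms(1) by (rule aalm_iterates_mem)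
  moreover have "?L (x (Suc k)) - (INF z. ?L z) \<le> ereal ((\<epsilon> k)\<^sup>2 / (2 * c k))"
    using assms by (simp add: aalm_def criterion_C_def)
  moreover have "(INF z. ?L z) \<le> ?L u" by (rule INF_lower) simp
  ultimately have "f0 (x (Suc k)) + 1 / (2 * c k) *
        ((norm (multiplier_update f (x (Suc k)) (y k) (c k)))\<^sup>2 - (norm (y k))\<^sup>2)
      \<le> f0 u + 1 / (2 * c k) * ((norm (multiplier_update f u (y k) (c k)))\<^sup>2 - (norm (y k))\<^sup>2)
        + (\<epsilon> k)\<^sup>2 / (2 * c k)"
    using \<open>u \<in> C\<close>
    \<comment> \<open>The infimum is finite: -\<infinity> would make the gap infinite, and
      \<infinity> exceeds the finite value at \<open>u\<close>.\<close>
    by (cases "INF z. ?L z") (auto simp: aug_lagrangian_def multiplier_update_def)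
  from mult_left_mono[OF this, of "2 * c k"] show ?thesis
    using c by (simp add: distrib_left)
qed

text \<open>A late term of an asymptotically feasible sequence violates each constraint by less than
  \<eta> and has objective below \<open>L\<close>. It serves as the comparison point, and then
  \<eta> tends to 0. Taking a real \<open>L\<close> strictly above the limsup also covers a limsup
  of -\<infinity>.\<close>

lemma aalm_asym_step:
  assumes run: "aalm C f0 f c \<epsilon> x y"
    and u: "\<forall>n. u n \<in> C" "\<forall>i. limsup (\<lambda>n. ereal (f i (u n))) \<le> 0"
    and L: "limsup (\<lambda>n. ereal (f0 (u n))) < ereal L"
  shows "2 * c k * f0 (x (Suc k)) + (norm (multiplier_update f (x (Suc k)) (y k) (c k)))\<^sup>2
    \<le> 2 * c k * L + (norm (y k))\<^sup>2 + (\<epsilon> k)\<^sup>2" (is "?X \<le> _")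
proof -
  have c: "0 < c k" using run by (simp add: aalm_def)
  have "?X \<le> 2 * c k * L + (norm (y k + (c k * \<eta>) *\<^sub>R 1))\<^sup>2 + (\<epsilon> k)\<^sup>2" if "0 < \<eta>" for \<eta>
  proof -
    have "\<forall>\<^sub>F n in sequentially. f0 (u n) < L"
      using Limsup_lessD[OF L] by simp
    moreover have "\<forall>\<^sub>F n in sequentially. f i (u n) < \<eta>" for i
    proof -
      have "limsup (\<lambda>n. ereal (f i (u n))) < ereal \<eta>"
        using u(2) that by (metis ereal_less(2) order.strict_trans1)
      from Limsup_lessD[OF this] show ?thesis by simp
    qed
    ultimately have "\<forall>\<^sub>F n in sequentially. f0 (u n) < L \<and> (\<forall>i. f i (u n) < \<eta>)"
      by (intro eventually_conj eventually_all_finite) auto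
    then obtain n where n: "f0 (u n) < L" "\<And>i. f i (u n) < \<eta>"
      by (auto simp: eventually_sequentially)
    have "norm (multiplier_update f (u n) (y k) (c k)) \<le> norm (y k + (c k * \<eta>) *\<^sub>R 1)"
      unfolding multiplier_update_def
      using n(2) c that aalm_multiplier_nonneg[OF run]
      by (intro norm_closest_point_nonneg_orthant_le) (auto intro: less_imp_le)
    then have "(norm (multiplier_update f (u n) (y k) (c k)))\<^sup>2 \<le> (norm (y k + (c k * \<eta>) *\<^sub>R 1))\<^sup>2"
      by (intro power_mono) auto
    moreover have "2 * c k * f0 (u n) \<le> 2 * c k * L" using n(1) c by simp
    ultimately show ?thesis using aalm_approx_min[OF run u(1)[rule_format], of k n] by linarith
  qed
  \<comment> \<open>The limit is one-sided since the bound is available for positive \<eta>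
    only.\<close>
  then have "\<forall>\<^sub>F \<eta> in at_right 0.
      ?X \<le> 2 * c k * L + (norm (y k + (c k * \<eta>) *\<^sub>R 1))\<^sup>2 + (\<epsilon> k)\<^sup>2"
    by (auto intro: eventually_at_right_less[THEN eventually_mono])
  moreover have "((\<lambda>\<eta>. 2 * c k * L + (norm (y k + (c k * \<eta>) *\<^sub>R 1))\<^sup>2 + (\<epsilon> k)\<^sup>2)
      \<longlongrightarrow> 2 * c k * L + (norm (y k + (c k * 0) *\<^sub>R 1))\<^sup>2 + (\<epsilon> k)\<^sup>2) (at_right 0)"
    by (intro tendsto_intros)
  ultimately show ?thesis
    using tendsto_lowerbound[of _ _ "at_right (0::real)" ?X] by fastforce
qed

section \<open>Harmonic and telescoping sums\<close>

lemma sum_inverse_le_ln: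
  assumes "1 \<le> K"
  shows "(\<Sum>k<K. 1 / (real k + 1)) \<le> 1 + ln (real K)"
proof -
  have "(\<Sum>k<K. 1 / (real k + 1)) = harm K"
    by (simp add: harm_def sum.atLeast1_atMost_eq divide_inverse add.commute)
  \<comment> \<open>The difference \<open>harm n - ln n\<close> decreases from its value 1 at n = 1;
    the indices 0 and \<open>K - 1\<close> reflect a shift by \<open>Suc\<close>.\<close>
  moreover have "harm K - ln (real K) \<le> 1"
    using decseqD[OF decseq_harm_diff_ln, of 0 "K - 1"] assms by (simp add: harm_Suc harm_expand)
  ultimately show ?thesis by simp
qed

text \<open>Entries of the multipliers lie between 0 and \<Delta>. Hence the telescoped increments
  contribute at most \<Delta>, and the corrections at most \<Delta> times the harmonic sum.\<close>

lemma aalm_constraint_sum: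
  assumes run: "aalm C f0 f c \<epsilon> x y" and \<Delta>: "\<And>k. norm (y k) \<le> \<Delta>" and K: "1 \<le> K"
  shows "(\<Sum>k<K. c k * f i (x (Suc k))) \<le> 2 * \<Delta> + \<Delta> * ln (real K)"
proof -
  have y: "0 \<le> y k $ i" "y k $ i \<le> \<Delta>" for k
    using aalm_multiplier_nonneg[OF run, of k] \<Delta>[of k] component_le_norm_cart[of "y k" i]
    by (auto simp: nonneg_orthant_def)
  have "0 \<le> \<Delta>" using y(1)[of 0] y(2)[of 0] by linarith
  have "c k * f i (x (Suc k)) \<le> (y (Suc k) $ i - y k $ i) + \<Delta> * (1 / (real k + 1))" for k
  proof -
    have "(y (Suc k) $ i - y 0 $ i) * (1 / (real k + 1)) \<le> \<Delta> * (1 / (real k + 1))"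
      using y(2)[of "Suc k"] y(1)[of 0] by (intro mult_right_mono) auto
    then show ?thesis
      using multiplier_update_ge[of "c k" f i "x (Suc k)" "y k"]
      by (simp add: aalm_multiplier_update_eq[OF run])
  qed
  then have "(\<Sum>k<K. c k * f i (x (Suc k)))
      \<le> (\<Sum>k<K. (y (Suc k) $ i - y k $ i) + \<Delta> * (1 / (real k + 1)))"
    by (intro sum_mono)
  also have "\<dots> = (y K $ i - y 0 $ i) + \<Delta> * (\<Sum>k<K. 1 / (real k + 1))"
    unfolding sum.distrib sum_distrib_left
    by (simp add: sum_lessThan_telescope[of "\<lambda>k. y k $ i"])
  also have "\<dots> \<le> \<Delta> + \<Delta> * (1 + ln (real K))"
    using y(2)[of K] y(1)[of 0] \<open>0 \<le> \<Delta>\<close> sum_inverse_le_ln[OF K]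
    by (intro add_mono mult_left_mono) auto
  finally show ?thesis by (simp add: algebra_simps)
qed

text \<open>The squared norm of the projected multiplier is at least that of
  \<open>y (Suc k)\<close> minus 2 \<Delta>^2/(k+1). Inserted into the one-step bound, this leaves a
  telescoping difference and a harmonic sum.\<close>

lemma aalm_objective_sum:
  assumes run: "aalm C f0 f c \<epsilon> x y" and \<Delta>: "\<And>k. norm (y k) \<le> \<Delta>" and K: "1 \<le> K"
    and u: "\<forall>n. u n \<in> C" "\<forall>i. limsup (\<lambda>n. ereal (f i (u n))) \<le> 0"
    and L: "limsup (\<lambda>n. ereal (f0 (u n))) < ereal L"
  shows "2 * (\<Sum>k<K. c k * f0 (x (Suc k)))
    \<le> 2 * (\<Sum>k<K. c k) * L + (\<Sum>k<K. (\<epsilon> k)\<^sup>2) + 3 * \<Delta>\<^sup>2 + 2 * \<Delta>\<^sup>2 * ln (real K)"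
proof -
  \<comment> \<open>The difference is written with negated squares to match the telescoping
    rule.\<close>
  have "2 * (c k * f0 (x (Suc k))) \<le> 2 * (c k * L) + (\<epsilon> k)\<^sup>2
      + (- (norm (y (Suc k)))\<^sup>2 - (- (norm (y k))\<^sup>2)) + 2 * \<Delta>\<^sup>2 * (1 / (real k + 1))" for k
  proof -
    let ?v = "y (Suc k)" and ?t = "1 / (real k + 1)"
    have "?v \<bullet> y 0 \<le> \<Delta> * \<Delta>"
      using norm_cauchy_schwarz[of ?v "y 0"] \<Delta>[of "Suc k"] \<Delta>[of 0]
      by (meson mult_mono norm_ge_zero order_trans)
    then have upper: "?t * (?v \<bullet> y 0 - ?v \<bullet> ?v) \<le> ?t * \<Delta>\<^sup>2"
      by (intro mult_left_mono) (auto simp: power2_eq_square intro: order_trans[of _ "?v \<bullet> y 0"])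
    \<comment> \<open>Expansion of the square; its last summand is nonnegative and is dropped in
      \<open>lower\<close>.\<close>
    have "(norm (?v + t *\<^sub>R (?v - y 0)))\<^sup>2
        = (norm ?v)\<^sup>2 + 2 * (t * (?v \<bullet> ?v - ?v \<bullet> y 0)) + (t * norm (?v - y 0))\<^sup>2"
      for t
      by (simp add: power_mult_distrib power2_norm_eq_inner inner_simps inner_commute)
        (simp add: algebra_simps power2_eq_square)
    from this[of ?t] have lower: "(norm (?v + ?t *\<^sub>R (?v - y 0)))\<^sup>2
        \<ge> (norm ?v)\<^sup>2 - 2 * (?t * (?v \<bullet> y 0 - ?v \<bullet> ?v))"
      by (simp add: right_diff_distrib)
    have "(norm ?v)\<^sup>2 - 2 * (?t * \<Delta>\<^sup>2) \<le> (norm (?v + ?t *\<^sub>R (?v - y 0)))\<^sup>2"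
      using upper lower by linarith
    then show ?thesis
      using aalm_asym_step[OF run u L, of k] by (simp add: aalm_multiplier_update_eq[OF run])
  qed
  then have "(\<Sum>k<K. 2 * (c k * f0 (x (Suc k)))) \<le> (\<Sum>k<K. 2 * (c k * L) + (\<epsilon> k)\<^sup>2
      + (- (norm (y (Suc k)))\<^sup>2 - (- (norm (y k))\<^sup>2)) + 2 * \<Delta>\<^sup>2 * (1 / (real k + 1)))"
    by (intro sum_mono)
  also have "\<dots> = 2 * (\<Sum>k<K. c k) * L + (\<Sum>k<K. (\<epsilon> k)\<^sup>2)
      + ((norm (y 0))\<^sup>2 - (norm (y K))\<^sup>2) + 2 * \<Delta>\<^sup>2 * (\<Sum>k<K. 1 / (real k + 1))"
    unfolding sum.distrib sum_lessThan_telescope[of "\<lambda>k. - (norm (y k))\<^sup>2"]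
    by (simp add: sum_distrib_left sum_distrib_right mult.assoc)
  also have "\<dots> \<le> 2 * (\<Sum>k<K. c k) * L + (\<Sum>k<K. (\<epsilon> k)\<^sup>2) + \<Delta>\<^sup>2 + 2 * \<Delta>\<^sup>2 * (1 + ln (real K))"
  proof (intro add_mono order_refl)
    have "(norm (y 0))\<^sup>2 \<le> \<Delta>\<^sup>2" using \<Delta>[of 0] by (intro power_mono) auto
    then show "(norm (y 0))\<^sup>2 - (norm (y K))\<^sup>2 \<le> \<Delta>\<^sup>2" using zero_le_power2[of "norm (y K)"] by linarith
  qed (use sum_inverse_le_ln[OF K] in \<open>simp add: mult_left_mono\<close>)
  finally show ?thesis by (simp add: algebra_simps sum_distrib_left)
qed

section \<open>Passage to the weighted average\<close>

lemma convex_on_weighted_avg_le: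
  assumes "convex_on UNIV g" and "\<And>k. 0 < c k" and "1 \<le> K"
  shows "g (weighted_avg c x K) \<le> (\<Sum>k<K. c k * g (x (Suc k))) / (\<Sum>k<K. c k)"
proof -
  let ?S = "\<Sum>k<K. c k"
  have S: "0 < ?S" using assms by (intro sum_pos) (auto simp: lessThan_empty_iff)
  have "weighted_avg c x K = (\<Sum>k<K. (c k / ?S) *\<^sub>R x (Suc k))"
    by (simp add: weighted_avg_def sum.atLeast1_atMost_eq scaleR_sum_right divide_inverse mult.commute)
  \<comment> \<open>Jensen's inequality with the normalised weights \<open>c k / ?S\<close>.\<close>
  moreover have "g (\<Sum>k<K. (c k / ?S) *\<^sub>R x (Suc k)) \<le> (\<Sum>k<K. c k / ?S * g (x (Suc k)))"
    using assms S
    by (intro convex_on_sum[where C = UNIV]) (auto simp: sum_divide_distrib[symmetric] less_imp_le)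
  ultimately show ?thesis by (simp add: sum_divide_distrib)
qed

text \<open>The free lower bound \<open>b\<close> on the total weight lets one statement serve both
  parameter rules.\<close>

lemma aalm_constraint_avg:
  assumes run: "aalm C f0 f c \<epsilon> x y" and \<Delta>: "\<And>k. norm (y k) \<le> \<Delta>" and K: "1 \<le> K"
    and f: "convex_on UNIV (f i)" and b: "0 < b" "b \<le> (\<Sum>k<K. c k)"
  shows "f i (weighted_avg c x K) \<le> (2 * \<Delta> + \<Delta> * ln (real K)) / b"
proof -
  have "0 \<le> \<Delta>" using \<Delta>[of 0] norm_ge_zero order_trans by blast
  have "f i (weighted_avg c x K) \<le> (\<Sum>k<K. c k * f i (x (Suc k))) / (\<Sum>k<K. c k)"
    using run by (intro convex_on_weighted_avg_le f K) (auto simp: aalm_def)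
  also have "\<dots> \<le> (2 * \<Delta> + \<Delta> * ln (real K)) / (\<Sum>k<K. c k)"
    using aalm_constraint_sum[OF run \<Delta> K] b by (intro divide_right_mono) auto
  also have "\<dots> \<le> (2 * \<Delta> + \<Delta> * ln (real K)) / b"
    using b K \<open>0 \<le> \<Delta>\<close> by (intro divide_left_mono) auto
  finally show ?thesis .
qed

lemma aalm_objective_avg:
  assumes run: "aalm C f0 f c \<epsilon> x y" and \<Delta>: "\<And>k. norm (y k) \<le> \<Delta>" and K: "1 \<le> K"
    and f0: "convex_on UNIV f0" and b: "0 < b" "b \<le> (\<Sum>k<K. c k)"
  shows "ereal (f0 (weighted_avg c x K)) - asym_inf C f0 f
    \<le> ereal (((\<Sum>k<K. (\<epsilon> k)\<^sup>2) + 3 * \<Delta>\<^sup>2 + 2 * \<Delta>\<^sup>2 * ln (real K)) / (2 * b))"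
proof -
  let ?S = "\<Sum>k<K. c k" and ?w = "f0 (weighted_avg c x K)"
  let ?N = "(\<Sum>k<K. (\<epsilon> k)\<^sup>2) + 3 * \<Delta>\<^sup>2 + 2 * \<Delta>\<^sup>2 * ln (real K)"
  have S: "0 < ?S" using b by linarith
  have N: "0 \<le> ?N" using K by (auto intro!: add_nonneg_nonneg sum_nonneg)
  \<comment> \<open>Bounding every admissible limsup from below avoids subtracting a possibly
    infinite value.\<close>
  have "ereal (?w - ?N / (2 * b)) \<le> limsup (\<lambda>n. ereal (f0 (u n)))"
    if u: "\<forall>n. u n \<in> C" "\<forall>i. limsup (\<lambda>n. ereal (f i (u n))) \<le> 0" for u
  proof (rule ccontr)
    assume "\<not> ?thesis"
    then obtain L where L: "limsup (\<lambda>n. ereal (f0 (u n))) < ereal L" "ereal L < ereal (?w - ?N / (2 * b))"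
      using ereal_dense2 by (meson not_le)
    have "?w \<le> (\<Sum>k<K. c k * f0 (x (Suc k))) / ?S"
      using run by (intro convex_on_weighted_avg_le f0 K) (auto simp: aalm_def)
    also have "\<dots> \<le> (2 * ?S * L + ?N) / 2 / ?S"
      using aalm_objective_sum[OF run \<Delta> K u L(1)] S by (intro divide_right_mono) auto
    also have "\<dots> = L + ?N / (2 * ?S)" using S by (simp add: field_simps)
    also have "\<dots> \<le> L + ?N / (2 * b)"
      using b N by (intro add_left_mono divide_left_mono) auto
    finally show False using L(2) by simp
  qed
  then have "ereal (?w - ?N / (2 * b)) \<le> asym_inf C f0 f"
    unfolding asym_inf_def by (intro Inf_greatest) auto
  \<comment> \<open>The lower bound excludes -\<infinity>; for \<infinity> the difference is
    -\<infinity>.\<close>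
  then show ?thesis by (cases "asym_inf C f0 f") (auto simp: algebra_simps)
qed

section \<open>The error series\<close>

lemma sum_inverse_squares_le_1: "(\<Sum>k<K. 1 / (real k + 2)\<^sup>2) \<le> 1"
proof -
  \<comment> \<open>The sharper bound makes the induction work, as 1/(k+2)^2 is at most 1/(k+1) -
    1/(k+2).\<close>
  have "(\<Sum>k<K. 1 / (real k + 2)\<^sup>2) \<le> 1 - 1 / (real K + 1)"
  proof (induction K)
    case (Suc K)
    have "1 / (real K + 2)\<^sup>2 \<le> 1 / (real K + 1) - 1 / (real K + 2)"
    proof -
      have "1 / (real K + 2)\<^sup>2 \<le> 1 / ((real K + 1) * (real K + 2))"
        unfolding power2_eq_square by (intro frac_le mult_right_mono) auto
      also have "\<dots> = 1 / (real K + 1) - 1 / (real K + 2)" by (simp add: field_simps)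
      finally show ?thesis .
    qed
    with Suc show ?case by (simp add: algebra_simps)
  qed simp
  also have "\<dots> \<le> 1" by simp
  finally show ?thesis .
qed

text \<open>Each term is at most 1/(k+2)^2, so the sum is at most 1, while the constant on the right
  equals 1 + 1/(1 + 2 \<delta>).\<close>

lemma sum_powr_squares_le:
  assumes "0 < (\<delta>::real)"
  shows "(\<Sum>k<K. (1 / (real k + 2) powr (1 + \<delta>))\<^sup>2) \<le> 2 * (1 + \<delta>) / (1 + 2 * \<delta>)"
proof -
  have "(1 / (real k + 2) powr (1 + \<delta>))\<^sup>2 \<le> 1 / (real k + 2)\<^sup>2" for k
  proof -
    have "(real k + 2) powr 1 \<le> (real k + 2) powr (1 + \<delta>)"
      using assms by (intro powr_mono) auto
    then have "(real k + 2)\<^sup>2 \<le> ((real k + 2) powr (1 + \<delta>))\<^sup>2"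
      by (intro power_mono) auto
    then show ?thesis
      unfolding power_divide by (intro frac_le) auto
  qed
  then have "(\<Sum>k<K. (1 / (real k + 2) powr (1 + \<delta>))\<^sup>2) \<le> (\<Sum>k<K. 1 / (real k + 2)\<^sup>2)"
    by (intro sum_mono)
  also have "\<dots> \<le> 1" by (rule sum_inverse_squares_le_1)
  also have "1 \<le> 2 * (1 + \<delta>) / (1 + 2 * \<delta>)" using assms by (simp add: field_simps)
  finally show ?thesis .
qed

section \<open>The two parameter rules\<close>

theorem theorem4p2:
  fixes C :: "(real ^ 'n) set"
    and f0 :: "real ^ 'n \<Rightarrow> real"
    and f :: "'m::finite \<Rightarrow> real ^ 'n \<Rightarrow> real"
    and c :: "nat \<Rightarrow> real"
    and x :: "nat \<Rightarrow> real ^ 'n"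
    and y :: "nat \<Rightarrow> real ^ 'm"
    and \<delta> \<Delta>\<^sub>0 :: real
  assumes "C \<noteq> {}" and "closed C" and "convex C"
    and "convex_on UNIV f0" and "lsc f0"
    and "\<And>j. convex_on UNIV (f j)" and "\<And>j. lsc (f j)"
    and "dual_sup C f0 f > -\<infinity>"
    and "dual_solutions C f0 f \<noteq> {}"
    and "\<delta> > 0"
    and "aalm C f0 f c (\<lambda>k. 1 / (real k + 2) powr (1 + \<delta>)) x y"
    and "\<And>k. norm (y k) \<le> \<Delta>\<^sub>0"
  shows "(incseq c \<longrightarrow>
           (\<forall>k\<ge>1.
             (\<forall>i. f i (weighted_avg c x k)
                \<le> 1 / (c 0 * real k) * (3 * \<Delta>\<^sub>0 + 2 * \<Delta>\<^sub>0 * ln (real k))) \<and>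
             ereal (f0 (weighted_avg c x k)) - asym_inf C f0 f
                \<le> ereal (1 / (2 * c 0 * real k) *
                    (2 * (1 + \<delta>) / (1 + 2 * \<delta>) + 13 * \<Delta>\<^sub>0\<^sup>2 + 12 * \<Delta>\<^sub>0\<^sup>2 * ln (real k)))))
       \<and> ((\<forall>k. c k = c 0 * (real k + 1)) \<longrightarrow>
           (\<forall>k\<ge>1.
             (\<forall>i. f i (weighted_avg c x k)
                \<le> 2 / (c 0 * real k * (real k + 1)) * (3 * \<Delta>\<^sub>0 + 2 * \<Delta>\<^sub>0 * ln (real k))) \<and>
             ereal (f0 (weighted_avg c x k)) - asym_inf C f0 f
                \<le> ereal (1 / (c 0 * real k * (real k + 1)) *
                    (2 * (1 + \<delta>) / (1 + 2 * \<delta>) + 13 * \<Delta>\<^sub>0\<^sup>2 + 12 * \<Delta>\<^sub>0\<^sup>2 * ln (real k)))))"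
proof -
  note run = assms(11) and \<Delta> = assms(12)
  have c0: "0 < c 0" using run by (simp add: aalm_def)
  have D: "0 \<le> \<Delta>\<^sub>0" using \<Delta>[of 0] norm_ge_zero order_trans by blast
  \<comment> \<open>The rules differ only in \<open>b\<close>: c_0 k for increasing parameters and
    c_0 k(k+1)/2 for linear ones.\<close>
  have bounds: "(\<forall>i. f i (weighted_avg c x k)
        \<le> 1 / b * (3 * \<Delta>\<^sub>0 + 2 * \<Delta>\<^sub>0 * ln (real k))) \<and>
      ereal (f0 (weighted_avg c x k)) - asym_inf C f0 f
        \<le> ereal (1 / (2 * b) *
            (2 * (1 + \<delta>) / (1 + 2 * \<delta>) + 13 * \<Delta>\<^sub>0\<^sup>2 + 12 * \<Delta>\<^sub>0\<^sup>2 * ln (real k)))"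
    if k: "1 \<le> k" and b: "0 < b" "b \<le> (\<Sum>l<k. c l)" for k b
  proof (intro conjI allI)
    have ln: "0 \<le> ln (real k)" using k by simp
    have 1: "0 \<le> \<Delta>\<^sub>0 * ln (real k)" "0 \<le> \<Delta>\<^sub>0\<^sup>2 * ln (real k)" using ln D by auto
    fix i
    have "f i (weighted_avg c x k) \<le> (2 * \<Delta>\<^sub>0 + \<Delta>\<^sub>0 * ln (real k)) / b"
      using aalm_constraint_avg[OF run \<Delta> k assms(6) b] .
    \<comment> \<open>The sharper constants 2, 1 here and 3, 2 for the objective are relaxed to the
      stated ones, using \<open>ln (real k) \<ge> 0\<close>.\<close>
    also have "\<dots> \<le> (3 * \<Delta>\<^sub>0 + 2 * \<Delta>\<^sub>0 * ln (real k)) / b"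
      using 1 D b by (intro divide_right_mono) auto
    finally show "f i (weighted_avg c x k) \<le> 1 / b * (3 * \<Delta>\<^sub>0 + 2 * \<Delta>\<^sub>0 * ln (real k))"
      by simp
    have "((\<Sum>l<k. (1 / (real l + 2) powr (1 + \<delta>))\<^sup>2) + 3 * \<Delta>\<^sub>0\<^sup>2 + 2 * \<Delta>\<^sub>0\<^sup>2 * ln (real k)) / (2 * b)
        \<le> (2 * (1 + \<delta>) / (1 + 2 * \<delta>) + 13 * \<Delta>\<^sub>0\<^sup>2 + 12 * \<Delta>\<^sub>0\<^sup>2 * ln (real k)) / (2 * b)"
      using 1 b sum_powr_squares_le[OF \<open>\<delta> > 0\<close>, of k]
      by (intro divide_right_mono add_mono mult_right_mono) (auto simp: ln)
    then show "ereal (f0 (weighted_avg c x k)) - asym_inf C f0 f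
        \<le> ereal (1 / (2 * b) *
            (2 * (1 + \<delta>) / (1 + 2 * \<delta>) + 13 * \<Delta>\<^sub>0\<^sup>2 + 12 * \<Delta>\<^sub>0\<^sup>2 * ln (real k)))"
      using aalm_objective_avg[OF run \<Delta> k assms(4) b] by (auto intro: order_trans)
  qed
  show ?thesis
  \<comment> \<open>The instantiation splits only the outer conjunction, so each goal matches the
    shape of \<open>bounds\<close>.\<close>
  proof (intro conjI[of "_ \<longrightarrow> _"] impI allI)
    fix k :: nat
    assume inc: "incseq c" and k: "1 \<le> k"
    have "(\<Sum>l<k. c 0) \<le> (\<Sum>l<k. c l)"
      using inc by (intro sum_mono) (simp add: incseqD)
    then show "(\<forall>i. f i (weighted_avg c x k)
          \<le> 1 / (c 0 * real k) * (3 * \<Delta>\<^sub>0 + 2 * \<Delta>\<^sub>0 * ln (real k))) \<and>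
        ereal (f0 (weighted_avg c x k)) - asym_inf C f0 f
          \<le> ereal (1 / (2 * c 0 * real k) *
              (2 * (1 + \<delta>) / (1 + 2 * \<delta>) + 13 * \<Delta>\<^sub>0\<^sup>2 + 12 * \<Delta>\<^sub>0\<^sup>2 * ln (real k)))"
      using bounds[of k "c 0 * real k"] c0 k by (simp add: mult.commute mult.left_commute)
  next
    fix k :: nat
    assume c: "\<forall>k. c k = c 0 * (real k + 1)" and k: "1 \<le> k"
    have "(\<Sum>l<k. c l) = (\<Sum>l<k. c 0 * (real l + 1))"
      by (intro sum.cong refl c[rule_format])
    also have "\<dots> = c 0 * real k * (real k + 1) / 2"
      by (induction k) (simp_all add: field_simps)
    finally show "(\<forall>i. f i (weighted_avg c x k)
          \<le> 2 / (c 0 * real k * (real k + 1)) * (3 * \<Delta>\<^sub>0 + 2 * \<Delta>\<^sub>0 * ln (real k))) \<and>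
        ereal (f0 (weighted_avg c x k)) - asym_inf C f0 f
          \<le> ereal (1 / (c 0 * real k * (real k + 1)) *
              (2 * (1 + \<delta>) / (1 + 2 * \<delta>) + 13 * \<Delta>\<^sub>0\<^sup>2 + 12 * \<Delta>\<^sub>0\<^sup>2 * ln (real k)))"
      using bounds[of k "c 0 * real k * (real k + 1) / 2"] c0 k by simp
  qed
qed

end
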